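(* There exists a function $f\in HW^1_{(-\infty,\infty)}$ such that, for all $H>0$, every function $g$ equivalent to $f$ in the space $HW^1_{[-H,H]}$ does not belong to $HU_{[-H,H]}$.
   Context: For real $\alpha\le\beta$ let $\Pi_{[\alpha,\beta]}=\{z=x+iy\in\mathbf C:\ x\in\mathbf R,\ \alpha\le y\le\beta\}$. A finite exponential sum on $\Pi_{[\alpha,\beta]}$ is a function $\sum_{n=1}^N c_n(y)e^{i\lambda_n x}$ with $\lambda_n\in\mathbf R$ and $c_n$ continuous complex-valued functions on $[\alpha,\beta]$. For complex-valued functions $g,h$ on $\Pi_{[\alpha,\beta]}$ that are measurable and such that $|g(x+iy)|$, $|h(x+iy)|$ are locally integrable in $x$ for each fixed $y$, the Weyl distance of order $1$ is $$d^{W^1}_{[\alpha,\beta]}(g,h)=\limsup_{T\to\infty}\ \sup_{z\in\Pi_{[\alpha,\beta]}}\frac1{2T}\int_{-T}^{T}|g(z+t)-h(z+t)|\,dt.$$ $W^1_{[\alpha,\beta]}$ is the closure of the set of finite exponential sums in this (pseudo)metric: $f\in W^1_{[\alpha,\beta]}$ if for every $\varepsilon>0$ there is a finite exponential sum $Q$ with $d^{W^1}_{[\alpha,\beta]}(f,Q)<\varepsilon$. $U_{[\alpha,\beta]}$ is the space of (uniformly) almost periodic functions on $\Pi_{[\alpha,\beta]}$: continuous functions $f:\Pi_{[\alpha,\beta]}\to\mathbf C$ such that for every $\varepsilon>0$ the set $\{\tau\in\mathbf R:\ \sup_{z\in\Pi_{[\alpha,\beta]}}|f(z+\tau)-f(z)|<\varepsilon\}$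 is relatively dense in $\mathbf R$, i.e. there is $L=L(\varepsilon)>0$ such that every segment of length $L$ meets this set. The prefix $H$ denotes spaces of holomorphic functions. $HW^1_{(-\infty,\infty)}$ is the set of entire functions on $\mathbf C$ whose restriction to $\Pi_{[\alpha,\beta]}$ belongs to $W^1_{[\alpha,\beta]}$ for all real $\alpha<\beta$. For $H>0$, $HW^1_{[-H,H]}$ (respectively $HU_{[-H,H]}$) is the set of functions on $\Pi_{[-H,H]}$ that belong to $W^1_{[-H,H]}$ (respectively $U_{[-H,H]}$) and are holomorphic in the interior $\{|y|<H\}$ of the strip. A function $g$ is equivalent to $f$ in $HW^1_{[-H,H]}$ if $g\in HW^1_{[-H,H]}$ and $d^{W^1}_{[-H,H]}(f,g)=0$. *)

theory Defs
  imports "HOL-Analysis.Analysis"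
begin

text \<open>
  Functions on a strip are represented by total functions on the complex plane; every definition
  below depends only on the values on the strip in question.
\<close>

definition strip :: "real \<Rightarrow> real \<Rightarrow> complex set" where
  "strip \<alpha> \<beta> = {z. \<alpha> \<le> Im z \<and> Im z \<le> \<beta>}"

definition finite_exp_sum :: "real \<Rightarrow> real \<Rightarrow> (complex \<Rightarrow> complex) \<Rightarrow> bool" where
  "finite_exp_sum \<alpha> \<beta> Q \<longleftrightarrow>
     (\<exists>(N::nat) (c :: nat \<Rightarrow> real \<Rightarrow> complex) (lam :: nat \<Rightarrow> real).
        (\<forall>n\<in>{1..N}. continuous_on {\<alpha>..\<beta>} (c n)) \<and>
        (\<forall>z\<in>strip \<alpha> \<beta>.
           Q z = (\<Sum>n=1..N. c n (Im z) * exp (\<i> * of_real (lam n * Re z)))))"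

text \<open>
  Absolute integrability of the complex-valued function (and not only integrability of its
  modulus) on horizontal segments makes each section measurable, which a function measurable
  on the strip with respect to planar Lebesgue measure need not satisfy; this is needed for
  the integrals in the Weyl distance to be defined.
\<close>

definition weyl_admissible :: "real \<Rightarrow> real \<Rightarrow> (complex \<Rightarrow> complex) \<Rightarrow> bool" where
  "weyl_admissible \<alpha> \<beta> g \<longleftrightarrow>
     g \<in> borel_measurable (lebesgue_on (strip \<alpha> \<beta>)) \<and>
     (\<forall>y\<in>{\<alpha>..\<beta>}. \<forall>a b. (\<lambda>x. g (Complex x y)) absolutely_integrable_on {a..b})"

text \<open>
  The distance takes values in the extended reals, since the supremum and the upper limit may
  be infinite.  It is only meaningful for functions satisfying \<^const>\<open>weyl_admissible\<close>.
\<close>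

definition weyl_dist ::
  "real \<Rightarrow> real \<Rightarrow> (complex \<Rightarrow> complex) \<Rightarrow> (complex \<Rightarrow> complex) \<Rightarrow> ereal" where
  "weyl_dist \<alpha> \<beta> g h =
     Limsup at_top (\<lambda>T::real. SUP z\<in>strip \<alpha> \<beta>.
       ereal (1 / (2 * T) *
         integral {-T..T} (\<lambda>t. norm (g (z + of_real t) - h (z + of_real t)))))"

definition W1 :: "real \<Rightarrow> real \<Rightarrow> (complex \<Rightarrow> complex) set" where
  "W1 \<alpha> \<beta> = {f. weyl_admissible \<alpha> \<beta> f \<and>
     (\<forall>\<epsilon>>0. \<exists>Q. finite_exp_sum \<alpha> \<beta> Q \<and> weyl_dist \<alpha> \<beta> f Q < ereal \<epsilon>)}"

definition relatively_dense :: "real set \<Rightarrow> bool" where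
  "relatively_dense A \<longleftrightarrow> (\<exists>L>0. \<forall>a. {a..a + L} \<inter> A \<noteq> {})"

definition almost_periodic :: "real \<Rightarrow> real \<Rightarrow> (complex \<Rightarrow> complex) set" where
  "almost_periodic \<alpha> \<beta> = {f. continuous_on (strip \<alpha> \<beta>) f \<and>
     (\<forall>\<epsilon>>0. relatively_dense
        {\<tau>. (SUP z\<in>strip \<alpha> \<beta>. ereal (norm (f (z + of_real \<tau>) - f z))) < ereal \<epsilon>})}"

definition HW1_entire :: "(complex \<Rightarrow> complex) set" where
  "HW1_entire = {f. f holomorphic_on UNIV \<and> (\<forall>\<alpha> \<beta>. \<alpha> < \<beta> \<longrightarrow> f \<in> W1 \<alpha> \<beta>)}"

definition HW1 :: "real \<Rightarrow> real \<Rightarrow> (complex \<Rightarrow> complex) set" where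
  "HW1 \<alpha> \<beta> = {f \<in> W1 \<alpha> \<beta>. f holomorphic_on {z. \<alpha> < Im z \<and> Im z < \<beta>}}"

definition HU :: "real \<Rightarrow> real \<Rightarrow> (complex \<Rightarrow> complex) set" where
  "HU \<alpha> \<beta> = {f \<in> almost_periodic \<alpha> \<beta>. f holomorphic_on {z. \<alpha> < Im z \<and> Im z < \<beta>}}"

definition HW1_equivalent ::
  "real \<Rightarrow> real \<Rightarrow> (complex \<Rightarrow> complex) \<Rightarrow> (complex \<Rightarrow> complex) \<Rightarrow> bool" where
  "HW1_equivalent \<alpha> \<beta> f g \<longleftrightarrow> g \<in> HW1 \<alpha> \<beta> \<and> weyl_dist \<alpha> \<beta> f g = 0"

end

theory Submission
  imports Defs "HOL-Complex_Analysis.Cauchy_Integral_Formula"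
begin

text \<open>
  Let \<open>S\<close> be the set of integers \<open>4\<^sup>k (2 i + 1)\<close>, those of even 2-adic valuation.  The function is a
  sum of pulses of bounded width at the points of \<open>S\<close>; the pulses at the odd multiples of \<open>4\<^sup>k\<close>
  form the trigonometric polynomial \<open>sin (\<pi> z / p)\<close> to the power \<open>64 p\<^sup>2\<close> with \<open>p = 2 \<cdot> 4\<^sup>k\<close>, which is
  at most a constant multiple of \<open>exp (- 64 (x - n)\<^sup>2)\<close> on a horizontal strip, \<open>n\<close> being the nearest
  such point.  What remains after removing the first \<open>K\<close> of these is concentrated near the
  multiples of \<open>4\<^sup>K\<close>, hence small in the Weyl distance.

  A uniformly almost periodic function \<open>g\<close> at Weyl distance zero would have an almost period
  \<open>\<tau> \<ge> 1\<close> on the real line.  Rounding \<open>\<tau>\<close> to an integer \<open>m\<close>, a whole arithmetic progression of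
  points \<open>n\<close> satisfies \<open>n \<in> S\<close> and \<open>n + m \<notin> S\<close>, so that the sum is large near \<open>n\<close> and small near
  \<open>n + \<tau>\<close>: it differs from \<open>g\<close> on a set of positive density.
\<close>

subsection \<open>Pulses\<close>

text \<open>With \<open>u = v / 2\<close>, the inequality \<open>u * cos u <= sin u\<close> and the
  double angle formula give \<open>sin v >= v * (cos u)^2\<close>, and
  \<open>(cos u)^2 >= 1/2\<close> because \<open>u <= pi / 4\<close>.\<close>

lemma sin_ge_half:
  fixes v :: real
  assumes "0 \<le> v" "v \<le> pi / 2"
  shows "v / 2 \<le> sin v"
proof -
  define u where "u = v / 2"
  have u: "0 \<le> u" "u \<le> pi / 4"
    using assms by (auto simp: u_def)
  have "0 - 0 * cos 0 \<le> sin u - u * cos u"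
  proof -
    have "(\<lambda>t. sin t - t * cos t) 0 \<le> (\<lambda>t. sin t - t * cos t) u"
    proof (rule DERIV_nonneg_imp_nondecreasing [OF u(1)])
      fix t :: real assume t: "0 \<le> t" "t \<le> u"
      have "((\<lambda>t. sin t - t * cos t) has_real_derivative t * sin t) (at t)"
        by (auto intro!: derivative_eq_intros)
      moreover have "0 \<le> t * sin t"
        using t u by (intro mult_nonneg_nonneg sin_ge_zero) auto
      ultimately show "\<exists>y. ((\<lambda>t. sin t - t * cos t) has_real_derivative y) (at t) \<and> 0 \<le> y"
        by blast
    qed
    then show ?thesis by simp
  qed
  then have 1: "u * cos u \<le> sin u" by simp
  have c: "0 \<le> cos u"
    using u by (intro cos_ge_zero) auto
  have "cos (2 * u) \<ge> 0"
    using u by (intro cos_ge_zero) auto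
  then have c2: "1 / 2 \<le> (cos u)\<^sup>2"
    by (simp add: cos_double_cos)
  have "v / 2 = 2 * u * (1 / 2)" by (simp add: u_def)
  also have "\<dots> \<le> 2 * u * (cos u)\<^sup>2"
    using u c2 by (intro mult_left_mono) auto
  also have "\<dots> = 2 * (u * cos u) * cos u"
    by (simp add: power2_eq_square)
  also have "\<dots> \<le> 2 * sin u * cos u"
    using 1 c by (intro mult_right_mono) auto
  also have "\<dots> = sin v"
    by (simp add: u_def flip: sin_double)
  finally show ?thesis .
qed

lemma cos_squared_le:
  fixes v :: real
  assumes "\<bar>v\<bar> \<le> pi / 2"
  shows "(cos v)\<^sup>2 \<le> 1 - v\<^sup>2 / 4"
proof -
  have "\<bar>v\<bar> / 2 \<le> sin \<bar>v\<bar>"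
    using assms by (intro sin_ge_half) auto
  then have "(\<bar>v\<bar> / 2)\<^sup>2 \<le> (sin \<bar>v\<bar>)\<^sup>2"
    by (intro power_mono) auto
  then have "v\<^sup>2 / 4 \<le> (sin v)\<^sup>2"
    by (cases "v \<ge> 0") (auto simp: power_divide)
  then show ?thesis
    by (simp add: cos_squared_eq)
qed

lemma cos_squared_ge:
  fixes v :: real
  shows "1 - v\<^sup>2 \<le> (cos v)\<^sup>2"
proof -
  have "\<bar>sin v\<bar>\<^sup>2 \<le> \<bar>v\<bar>\<^sup>2"
    by (intro power_mono abs_sin_x_le_abs_x) auto
  then show ?thesis
    by (simp add: cos_squared_eq)
qed

lemma sinh_le_mult_exp:
  fixes v :: real
  shows "sinh v \<le> v * exp v"
proof -
  have "1 - 2 * v \<le> exp (- (2 * v))"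
    using exp_ge_add_one_self [of "- (2 * v)"] by simp
  then have "exp v * (1 - 2 * v) \<le> exp v * exp (- (2 * v))"
    by (intro mult_left_mono) auto
  also have "\<dots> = exp (- v)"
    by (simp flip: exp_add)
  finally show ?thesis
    by (simp add: sinh_def algebra_simps)
qed

lemma norm_sin_squared_sinh: "(norm (sin z))\<^sup>2 = (sin (Re z))\<^sup>2 + (sinh (Im z))\<^sup>2"
proof -
  have "exp (2 * Im z) = (exp (Im z))\<^sup>2" "inverse (exp (2 * Im z)) = (exp (- Im z))\<^sup>2"
    by (simp_all add: exp_double exp_minus power_inverse)
  moreover have "((exp (Im z) - exp (- Im z)) / 2)\<^sup>2 =
      ((exp (Im z))\<^sup>2 + (exp (- Im z))\<^sup>2 - 2) / 4"
  proof -
    have "exp (Im z) * exp (- Im z) = 1"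
      by (simp flip: exp_add)
    then show ?thesis
      by (simp add: power_divide power2_diff)
  qed
  ultimately show ?thesis
    unfolding norm_sin_squared cos_double_sin sinh_def
    by (simp add: diff_divide_distrib add_divide_distrib)
qed

text \<open>Moves the origin to an odd multiple of \<open>pi / 2\<close>, where the sine has modulus
  1; these points are the peaks of the pulses.\<close>

lemma sin_squared_odd_half_pi:
  "(sin (pi / 2 * of_int (2 * i + 1) + v))\<^sup>2 = (cos v)\<^sup>2" for v :: real
proof -
  have "pi / 2 * of_int (2 * i + 1) + v = (pi / 2 + v) + pi * of_int i"
    by (simp add: field_simps)
  then have "sin (pi / 2 * of_int (2 * i + 1) + v) =
      sin (pi / 2 + v) * cos (pi * of_int i)"
    by (simp only: sin_add sin_npi_int)
  moreover have "(cos (pi * of_int i))\<^sup>2 = 1"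
    by (simp add: cos_squared_eq)
  ultimately show ?thesis
    by (simp add: power_mult_distrib sin_add)
qed

lemma sixteen_power: "(16 :: real) ^ k = (4 ^ k)\<^sup>2"
  by (simp add: power2_eq_square flip: power_mult_distrib)

text \<open>A pulse of bounded width at each odd multiple of \<open>4 ^ k\<close>; the exponent grows like the
  square of the period so that the pulses do not spread.\<close>

definition pulse :: "nat \<Rightarrow> complex \<Rightarrow> complex" where
  "pulse k z = sin (of_real pi * z / (2 * 4 ^ k)) ^ (256 * 16 ^ k)"

section \<open>Peaks of the pulses and bounds for a single pulse\<close>

text \<open>The midpoint of the interval between consecutive multiples of \<open>2 * 4^k\<close>
  that contains \<open>x\<close>, hence an odd multiple of \<open>4^k\<close> nearest to
  \<open>x\<close>.\<close>

definition centre :: "nat \<Rightarrow> real \<Rightarrow> int" where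
  "centre k x = 4 ^ k * (2 * \<lfloor>x / (2 * 4 ^ k)\<rfloor> + 1)"

definition centres :: "int set" where
  "centres = {4 ^ k * (2 * i + 1) |k i. True}"

lemma centre_in_centres: "centre k x \<in> centres"
  by (auto simp: centre_def centres_def)

lemma abs_diff_centre_le: "\<bar>x - of_int (centre k x)\<bar> \<le> 4 ^ k"
proof -
  define j where "j = \<lfloor>x / (2 * 4 ^ k)\<rfloor>"
  have "of_int j \<le> x / (2 * 4 ^ k)" "x / (2 * 4 ^ k) \<le> of_int j + 1"
    by (simp_all add: j_def)
  then show ?thesis
    by (simp add: centre_def flip: j_def) (simp add: field_simps abs_le_iff)
qed

text \<open>Cancelling the smaller power of 4 would make an odd number equal to a multiple of
  4.\<close>

lemma pow4_odd_inject:
  fixes a b :: int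
  assumes "4 ^ j * (2 * a + 1) = 4 ^ k * (2 * b + 1)"
  shows "j = k"
proof -
  have aux: "\<not> j < k" if "4 ^ j * (2 * a + 1) = 4 ^ k * (2 * b + 1)" for j k and a b :: int
  proof
    assume "j < k"
    then obtain d where d: "k = Suc (j + d)"
      using less_imp_Suc_add by blast
    have "2 * a + 1 = 4 * (4 ^ d * (2 * b + 1))"
      using that by (simp add: d power_add mult.assoc)
    then show False by presburger
  qed
  show ?thesis
    using aux [OF assms] aux [OF assms [symmetric]] by linarith
qed

text \<open>Peaks of different levels never coincide, so a sum over levels at a fixed point becomes
  a sum over distinct integers.\<close>

lemma centre_inject: "centre j x = centre k x \<Longrightarrow> j = k"
  unfolding centre_def by (rule pow4_odd_inject)

text \<open>At distance \<open>d\<close> from the peak,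
  \<open>|sin w|^2 = (sin (Re w))^2 + (sinh (Im w))^2\<close> is at most
  \<open>1 + (B - 2 * d^2) / p^2\<close>, hence at most the exponential of that fraction. The
  exponent of the pulse is \<open>64 * p^2\<close>, so \<open>p\<close> cancels and the bound is
  uniform in \<open>k\<close>.\<close>

lemma norm_pulse_le:
  assumes "\<bar>Im z\<bar> \<le> Y"
  shows "norm (pulse k z) \<le>
    exp (32 * (pi * Y * exp (pi * Y))\<^sup>2) * exp (- 64 * (Re z - of_int (centre k (Re z)))\<^sup>2)"
proof -
  define p :: real where "p = 2 * 4 ^ k"
  define d where "d = Re z - of_int (centre k (Re z))"
  define B where "B = (pi * Y * exp (pi * Y))\<^sup>2"
  have Y: "0 \<le> Y" using assms by linarith
  have p: "p \<ge> 2" by (simp add: p_def)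
  have "\<bar>d\<bar> \<le> p / 2"
    using abs_diff_centre_le [of "Re z" k] by (simp add: d_def p_def)
  define w where "w = of_real pi * z / (2 * 4 ^ k)"
  have w: "w = of_real (pi / p) * z"
    by (simp add: w_def p_def)
  have Rew: "Re w = pi / p * Re z" and Imw: "Im w = pi / p * Im z"
    by (simp_all add: w)
  have "Re w = pi / 2 * of_int (2 * \<lfloor>Re z / (2 * 4 ^ k)\<rfloor> + 1) + pi * d / p"
    using p by (simp add: Rew d_def centre_def p_def field_simps)
  then have "(sin (Re w))\<^sup>2 = (cos (pi * d / p))\<^sup>2"
    using sin_squared_odd_half_pi by presburger
  also have "\<dots> \<le> 1 - (pi * d / p)\<^sup>2 / 4"
  proof (rule cos_squared_le)
    have "pi * \<bar>d\<bar> / p \<le> pi * (p / 2) / p"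
      using \<open>\<bar>d\<bar> \<le> p / 2\<close> p by (intro divide_right_mono mult_left_mono) auto
    then show "\<bar>pi * d / p\<bar> \<le> pi / 2"
      using p by (simp add: abs_mult)
  qed
  also have "\<dots> \<le> 1 - 2 * d\<^sup>2 / p\<^sup>2"
  proof -
    \<comment> \<open>Since \<open>pi^2 >= 9 >= 8\<close>, the coefficient \<open>pi^2 / 4\<close>
      may be replaced by 2.\<close>
    have "3\<^sup>2 \<le> pi\<^sup>2"
      using pi_gt3 by (intro power_mono) auto
    then have "8 * (d\<^sup>2 / p\<^sup>2) \<le> pi\<^sup>2 * (d\<^sup>2 / p\<^sup>2)"
      by (intro mult_right_mono) auto
    moreover have "(pi * d / p)\<^sup>2 = pi\<^sup>2 * (d\<^sup>2 / p\<^sup>2)"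
      by (simp add: power_divide power_mult_distrib)
    ultimately show ?thesis
      by linarith
  qed
  finally have s1: "(sin (Re w))\<^sup>2 \<le> 1 - 2 * d\<^sup>2 / p\<^sup>2" .
  have "sinh \<bar>Im w\<bar> \<le> \<bar>Im w\<bar> * exp \<bar>Im w\<bar>"
    by (rule sinh_le_mult_exp)
  also have "\<dots> \<le> (pi * Y / p) * exp (pi * Y)"
  proof (rule mult_mono)
    have "pi / p * \<bar>Im z\<bar> \<le> pi / p * Y"
      using assms p by (intro mult_left_mono) auto
    then show *: "\<bar>Im w\<bar> \<le> pi * Y / p"
      using p by (simp add: Imw abs_mult)
    \<comment> \<open>The linear factor already supplies the required \<open>1 / p\<close>; inside
      the exponential the crude bound \<open>p >= 1\<close> keeps the constant independent of
      \<open>k\<close>.\<close>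
    also have "\<dots> \<le> pi * Y / 1"
      using p Y by (intro divide_left_mono) auto
    finally show "exp \<bar>Im w\<bar> \<le> exp (pi * Y)" by simp
    show "0 \<le> pi * Y / p" using p Y by simp
  qed simp
  finally have "(sinh \<bar>Im w\<bar>)\<^sup>2 \<le> ((pi * Y / p) * exp (pi * Y))\<^sup>2"
    by (intro power_mono) auto
  then have s2: "(sinh (Im w))\<^sup>2 \<le> B / p\<^sup>2"
    by (simp add: B_def power_divide power_mult_distrib abs_if split: if_splits)
  have "(norm (sin w))\<^sup>2 \<le> 1 + (B - 2 * d\<^sup>2) / p\<^sup>2"
    using s1 s2 by (simp add: norm_sin_squared_sinh diff_divide_distrib)
  also have "\<dots> \<le> exp ((B - 2 * d\<^sup>2) / p\<^sup>2)"
    by (rule exp_ge_add_one_self)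
  finally have "((norm (sin w))\<^sup>2) ^ (128 * 16 ^ k) \<le> exp ((B - 2 * d\<^sup>2) / p\<^sup>2) ^ (128 * 16 ^ k)"
    by (intro power_mono) auto
  also have "\<dots> = exp (of_nat (128 * 16 ^ k) * ((B - 2 * d\<^sup>2) / p\<^sup>2))"
    by (rule exp_of_nat_mult [symmetric])
  also have "of_nat (128 * 16 ^ k) = 32 * p\<^sup>2"
    by (simp add: p_def power_mult_distrib sixteen_power)
  also have "exp (32 * p\<^sup>2 * ((B - 2 * d\<^sup>2) / p\<^sup>2)) = exp (32 * B) * exp (- 64 * d\<^sup>2)"
  proof -
    have "32 * p\<^sup>2 * ((B - 2 * d\<^sup>2) / p\<^sup>2) = 32 * B + - 64 * d\<^sup>2"
      using p by simp
    then show ?thesis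
      by (simp only: exp_add)
  qed
  finally show ?thesis
    by (simp add: pulse_def norm_power flip: power_mult w_def B_def d_def)
qed

text \<open>Bernoulli's inequality bounds the power of \<open>(cos (pi * t / p))^2\<close> below by
  \<open>1 - 32 * (pi * t)^2\<close>, again free of \<open>p\<close>; with \<open>pi < 4\<close> and
  \<open>|t| <= 1/40\<close> the loss is at most \<open>32 / 100\<close>.\<close>

lemma Re_pulse_of_real_ge:
  assumes "\<bar>t\<bar> \<le> 1 / 40"
  shows "68 / 100 \<le> Re (pulse k (of_real (of_int (4 ^ k * (2 * i + 1)) + t)))"
proof -
  define p :: real where "p = 2 * 4 ^ k"
  have p: "p \<ge> 2" by (simp add: p_def)
  define x where "x = of_int (4 ^ k * (2 * i + 1)) + t"
  have px: "pi * x / p = pi / 2 * of_int (2 * i + 1) + pi * t / p"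
    by (simp add: x_def p_def field_simps)
  have t: "\<bar>pi * t / p\<bar> \<le> 1"
  proof -
    have "pi * \<bar>t\<bar> \<le> 4 * (1 / 40)"
      using assms pi_less_4 by (intro mult_mono) auto
    then show ?thesis using p by (simp add: abs_mult divide_simps)
  qed
  have "pulse k (of_real x) = of_real (sin (pi * x / p) ^ (256 * 16 ^ k))"
    unfolding pulse_def p_def of_real_power sin_of_real [symmetric] by simp
  then have "Re (pulse k (of_real x)) = ((sin (pi * x / p))\<^sup>2) ^ (128 * 16 ^ k)"
    by (simp flip: power_mult)
  also have "\<dots> = ((cos (pi * t / p))\<^sup>2) ^ (128 * 16 ^ k)"
    by (simp only: px sin_squared_odd_half_pi)
  also have "\<dots> \<ge> (1 + (- (pi * t / p)\<^sup>2)) ^ (128 * 16 ^ k)"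
    using cos_squared_ge [of "pi * t / p"] t
    by (intro power_mono) (auto simp: abs_square_le_1)
  also have "(1 + (- (pi * t / p)\<^sup>2)) ^ (128 * 16 ^ k) \<ge> 1 + of_nat (128 * 16 ^ k) * (- (pi * t / p)\<^sup>2)"
    using t by (intro Bernoulli_inequality) (auto simp: abs_square_le_1)
  also have "of_nat (128 * 16 ^ k) = 32 * p\<^sup>2"
    by (simp add: p_def power_mult_distrib sixteen_power)
  also have "1 + 32 * p\<^sup>2 * (- (pi * t / p)\<^sup>2) = 1 - 32 * (pi * \<bar>t\<bar>)\<^sup>2"
    using p by (simp add: power_mult_distrib power_divide)
  finally have "1 - 32 * (pi * \<bar>t\<bar>)\<^sup>2 \<le> Re (pulse k (of_real x))" .
  moreover have "(pi * \<bar>t\<bar>)\<^sup>2 \<le> (4 * (1 / 40))\<^sup>2"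
    using assms pi_less_4 by (intro power_mono mult_mono) auto
  ultimately show ?thesis
    by (simp add: x_def power2_eq_square)
qed

text \<open>The exponent is even, so pulses cannot cancel one another on the real line.\<close>

lemma pulse_of_real_nonneg: "0 \<le> Re (pulse k (of_real x))"
proof -
  have "pulse k (of_real x) = of_real (sin (pi * x / (2 * 4 ^ k)) ^ (256 * 16 ^ k))"
    unfolding pulse_def of_real_power sin_of_real [symmetric] by simp
  then have "Re (pulse k (of_real x)) = sin (pi * x / (2 * 4 ^ k)) ^ (256 * 16 ^ k)"
    by (simp only: Re_complex_of_real)
  then show ?thesis
    by (simp add: zero_le_even_power)
qed

subsection \<open>The sum of the pulses\<close>

text \<open>The absolute value is injective on the nonnegative and on the negative values of
  \<open>i\<close> separately; each half is dominated by one geometric series.\<close>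

lemma sum_power_nat_abs_le:
  fixes i :: "'a \<Rightarrow> int" and s :: real
  assumes "finite A" "inj_on i A" "0 \<le> s" "s < 1"
  shows "(\<Sum>k\<in>A. s ^ nat \<bar>i k\<bar>) \<le> 2 / (1 - s)"
proof -
  have *: "(\<Sum>k\<in>B. s ^ nat \<bar>i k\<bar>) \<le> 1 / (1 - s)"
    if B: "finite B" "inj_on (\<lambda>k. nat \<bar>i k\<bar>) B" for B
  proof -
    have "(\<Sum>k\<in>B. s ^ nat \<bar>i k\<bar>) = (\<Sum>n\<in>(\<lambda>k. nat \<bar>i k\<bar>) ` B. s ^ n)"
      using B by (simp add: sum.reindex)
    also have "\<dots> \<le> (\<Sum>n. s ^ n)"
      using assms B by (intro sum_le_suminf) auto
    also have "\<dots> = 1 / (1 - s)"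
      using assms by (intro suminf_geometric) auto
    finally show ?thesis .
  qed
  have "(\<Sum>k\<in>A. s ^ nat \<bar>i k\<bar>) =
      (\<Sum>k\<in>{k \<in> A. 0 \<le> i k}. s ^ nat \<bar>i k\<bar>) + (\<Sum>k\<in>{k \<in> A. \<not> 0 \<le> i k}. s ^ nat \<bar>i k\<bar>)"
    using assms(1) by (subst sum.union_disjoint [symmetric]) (auto intro: sum.cong)
  also have "\<dots> \<le> 1 / (1 - s) + 1 / (1 - s)"
    using assms(1,2) by (intro add_mono *) (auto simp: inj_on_def)
  finally show ?thesis by simp
qed

text \<open>Let \<open>d\<close> be the distance from \<open>x\<close> to \<open>n k\<close> and
  \<open>i\<close> the offset of \<open>n k\<close> from \<open>round x\<close>. Then
  \<open>d >= 1/4\<close> and \<open>d >= |i| - 1/2\<close> give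
  \<open>|i| + 1 <= 4 * d <= 16 * d^2\<close>, so the terms are dominated by powers of
  \<open>exp (- 4) <= 1/16\<close>, and \<open>2 * s / (1 - s)\<close> is at most
  \<open>2/15\<close>.\<close>

lemma sum_gauss_far_le:
  fixes n :: "'a \<Rightarrow> int" and x :: real
  assumes "finite A" "inj_on n A" and far: "\<And>k. k \<in> A \<Longrightarrow> 1 / 4 \<le> \<bar>x - of_int (n k)\<bar>"
  shows "(\<Sum>k\<in>A. exp (- 64 * (x - of_int (n k))\<^sup>2)) \<le> 2 / 15"
proof -
  define s :: real where "s = exp (- 4)"
  have s0: "0 < s" by (simp add: s_def)
  have "2 ^ 4 \<le> exp (1 :: real) ^ 4"
    using exp_ge_add_one_self [of "1 :: real"] by (intro power_mono) auto
  also have "\<dots> = exp 4"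
    by (simp flip: exp_of_nat_mult)
  finally have s1: "s \<le> 1 / 16"
    by (simp add: s_def exp_minus field_simps)
  define i where "i k = n k - round x" for k
  have term_le: "exp (- 64 * (x - of_int (n k))\<^sup>2) \<le> s * s ^ nat \<bar>i k\<bar>" if "k \<in> A" for k
  proof -
    define d where "d = \<bar>x - of_int (n k)\<bar>"
    have d: "1 / 4 \<le> d" using far [OF that] by (simp add: d_def)
    have "\<bar>of_int (round x) - x\<bar> \<le> 1 / 2"
      by (rule of_int_round_abs_le)
    then have "real_of_int \<bar>i k\<bar> - 1 / 2 \<le> d"
      unfolding i_def d_def of_int_abs of_int_diff by linarith
    moreover have "\<bar>i k\<bar> = 0 \<or> \<bar>i k\<bar> \<ge> 1" by linarith
    ultimately have "real_of_int (\<bar>i k\<bar> + 1) \<le> 4 * d"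
      using d by auto
    also have "4 * d \<le> 16 * (d * d)"
      using mult_right_mono [OF d, of d] d by simp
    finally have "of_int (\<bar>i k\<bar> + 1) \<le> 16 * d\<^sup>2"
      by (simp add: power2_eq_square)
    then have "exp (- 64 * (x - of_int (n k))\<^sup>2) \<le> exp (of_nat (Suc (nat \<bar>i k\<bar>)) * (- 4))"
      by (simp add: d_def)
    also have "\<dots> = s * s ^ nat \<bar>i k\<bar>"
      unfolding s_def exp_of_nat_mult by simp
    finally show ?thesis .
  qed
  have "(\<Sum>k\<in>A. exp (- 64 * (x - of_int (n k))\<^sup>2)) \<le> s * (\<Sum>k\<in>A. s ^ nat \<bar>i k\<bar>)"
    unfolding sum_distrib_left by (intro sum_mono term_le)
  also have "\<dots> \<le> s * (2 / (1 - s))"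
    using assms s0 s1 by (intro mult_left_mono sum_power_nat_abs_le) (auto simp: inj_on_def i_def)
  also have "\<dots> \<le> 2 / 15"
    using s0 s1 by (simp add: field_simps)
  finally show ?thesis .
qed

text \<open>Write \<open>n k = P * (j + i)\<close> and \<open>u = x - P * j\<close>. As
  \<open>|u| <= P / 2\<close>, the square \<open>(u - P * i)^2\<close> is at least
  \<open>u^2 + P^2 * (i^2 - |i|)\<close>, hence at least \<open>u^2 + |i| - 1\<close>. This leaves a
  geometric series times the Gaussian in \<open>u\<close>; the factor \<open>exp 64\<close> pays for
  the \<open>- 1\<close>, and the constant does not depend on \<open>P\<close>.\<close>

lemma sum_gauss_multiples_le:
  fixes n :: "'a \<Rightarrow> int" and x :: real
  assumes "finite A" "inj_on n A" "1 \<le> P" and dvd: "\<And>k. k \<in> A \<Longrightarrow> P dvd n k"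
    and x: "\<bar>x - of_int (P * j)\<bar> \<le> of_int P / 2"
  shows "(\<Sum>k\<in>A. exp (- 64 * (x - of_int (n k))\<^sup>2)) \<le>
    (exp 64 * (2 / (1 - exp (- 64)))) * exp (- 64 * (x - of_int (P * j))\<^sup>2)"
proof -
  define u where "u = x - of_int (P * j)"
  define i where "i k = n k div P - j" for k
  have n_eq: "n k = P * (j + i k)" if "k \<in> A" for k
    using dvd [OF that] by (simp add: i_def)
  have term_le: "exp (- 64 * (x - of_int (n k))\<^sup>2) \<le>
      exp 64 * exp (- 64 * u\<^sup>2) * exp (- 64) ^ nat \<bar>i k\<bar>" if "k \<in> A" for k
  proof -
    define m where "m = \<bar>i k\<bar>"
    define p where "p = real_of_int P"
    have p: "1 \<le> p" using assms by (simp add: p_def)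
    have "x - of_int (n k) = u - p * of_int (i k)"
      by (simp add: n_eq [OF that] u_def p_def algebra_simps)
    moreover have "real_of_int (m * m) = of_int (i k) * of_int (i k)"
      by (simp add: m_def flip: of_int_mult)
    ultimately have "(x - of_int (n k))\<^sup>2 = u\<^sup>2 - 2 * p * (u * of_int (i k)) + p\<^sup>2 * of_int (m * m)"
      by (simp only: power2_eq_square) (simp add: algebra_simps)
    moreover have "u * of_int (i k) \<le> p / 2 * of_int m"
    proof -
      have "u * of_int (i k) \<le> \<bar>u\<bar> * of_int m"
        by (simp add: m_def flip: abs_mult)
      also have "\<dots> \<le> p / 2 * of_int m"
        using x by (intro mult_right_mono) (auto simp: u_def p_def m_def)
      finally show ?thesis .
    qed
    then have "2 * p * (u * of_int (i k)) \<le> 2 * p * (p / 2 * of_int m)"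
      using p by (intro mult_left_mono) auto
    ultimately have "u\<^sup>2 + p\<^sup>2 * of_int (m * m - m) \<le> (x - of_int (n k))\<^sup>2"
      by (simp add: power2_eq_square algebra_simps)
    moreover have "1 * real_of_int (m - 1) \<le> p\<^sup>2 * of_int (m * m - m)"
    proof (cases "m = 0")
      case False
      then have m: "1 \<le> m" by (simp add: m_def)
      have "m - 1 \<le> m * m - m"
        using mult_right_mono [of 1 m "m - 1"] m by (simp add: algebra_simps)
      moreover have "1 \<le> p\<^sup>2" using p by simp
      ultimately show ?thesis
        using m by (intro mult_mono) (auto simp flip: of_int_mult of_int_diff)
    qed simp
    ultimately have "u\<^sup>2 + of_int m - 1 \<le> (x - of_int (n k))\<^sup>2"
      by simp
    then have "exp (- 64 * (x - of_int (n k))\<^sup>2) \<le> exp (64 + - 64 * u\<^sup>2 + of_nat (nat m) * (- 64))"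
      by (simp add: m_def)
    also have "\<dots> = exp 64 * exp (- 64 * u\<^sup>2) * exp (- 64) ^ nat m"
      by (simp only: exp_add exp_of_nat_mult)
    finally show ?thesis by (simp add: m_def)
  qed
  have "inj_on i A"
    by (metis (no_types, lifting) assms(2) inj_on_def n_eq)
  then have "(\<Sum>k\<in>A. exp (- 64) ^ nat \<bar>i k\<bar>) \<le> 2 / (1 - exp (- 64 :: real))"
    using assms(1) by (intro sum_power_nat_abs_le) auto
  then have "exp 64 * exp (- 64 * u\<^sup>2) * (\<Sum>k\<in>A. exp (- 64) ^ nat \<bar>i k\<bar>)
      \<le> exp 64 * exp (- 64 * u\<^sup>2) * (2 / (1 - exp (- 64)))"
    by (intro mult_left_mono) auto
  moreover have "(\<Sum>k\<in>A. exp (- 64 * (x - of_int (n k))\<^sup>2))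
      \<le> exp 64 * exp (- 64 * u\<^sup>2) * (\<Sum>k\<in>A. exp (- 64) ^ nat \<bar>i k\<bar>)"
    unfolding sum_distrib_left by (intro sum_mono term_le)
  ultimately show ?thesis
    by (simp add: u_def mult_ac)
qed

section \<open>Convergence of the series and bounds for its tails\<close>

text \<open>The product of the strip constant in \<open>norm_pulse_le\<close> and the lattice
  constant in \<open>sum_gauss_multiples_le\<close>; it depends on neither the level nor the cutoff
  \<open>K\<close>.\<close>

definition pulse_bound :: "real \<Rightarrow> real" where
  "pulse_bound Y =
    exp (32 * (pi * Y * exp (pi * Y))\<^sup>2) * (exp 64 * (2 / (1 - exp (- 64))))"

lemma pulse_bound_pos: "0 < pulse_bound Y"
  by (simp add: pulse_bound_def)

text \<open>For \<open>k >= K\<close> every peak is a multiple of \<open>4^K\<close>, so the lattice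
  estimate applies with \<open>P = 4^K\<close>.\<close>

lemma sum_norm_pulse_le:
  assumes "finite A" "A \<subseteq> {K..}" "\<bar>Im z\<bar> \<le> Y" and z: "\<bar>Re z - 4 ^ K * of_int j\<bar> \<le> 4 ^ K / 2"
  shows "(\<Sum>k\<in>A. norm (pulse k z)) \<le> pulse_bound Y * exp (- 64 * (Re z - 4 ^ K * of_int j)\<^sup>2)"
proof -
  define c where "c = exp (32 * (pi * Y * exp (pi * Y))\<^sup>2)"
  have "(\<Sum>k\<in>A. norm (pulse k z)) \<le>
      c * (\<Sum>k\<in>A. exp (- 64 * (Re z - of_int (centre k (Re z)))\<^sup>2))"
    unfolding sum_distrib_left c_def using assms by (intro sum_mono norm_pulse_le)
  also have "\<dots> \<le> c * ((exp 64 * (2 / (1 - exp (- 64)))) * exp (- 64 * (Re z - of_int (4 ^ K * j))\<^sup>2))"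
  proof (intro mult_left_mono sum_gauss_multiples_le)
    show "4 ^ K dvd centre k (Re z)" if "k \<in> A" for k
      using that assms(2) by (auto simp: centre_def intro!: dvd_mult2 le_imp_power_dvd)
    show "inj_on (\<lambda>k. centre k (Re z)) A"
      by (auto simp: inj_on_def dest: centre_inject)
  qed (use assms in \<open>auto simp: c_def\<close>)
  finally show ?thesis
    by (simp add: pulse_bound_def c_def mult_ac)
qed

definition pulse_sum :: "complex \<Rightarrow> complex" where
  "pulse_sum z = (\<Sum>k. pulse k z)"

lemma summable_norm_pulse: "summable (\<lambda>k. norm (pulse k z))"
proof (rule summableI_nonneg_bounded)
  fix n
  \<comment> \<open>The cutoff \<open>K = 0\<close> covers all levels; rounding provides the nearest
    lattice point.\<close>
  have "\<bar>Re z - 4 ^ 0 * of_int (round (Re z))\<bar> \<le> 4 ^ 0 / 2"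
    using of_int_round_abs_le [of "Re z"] by (simp add: abs_minus_commute)
  from sum_norm_pulse_le [OF finite_lessThan _ order_refl this, of n]
  show "(\<Sum>k<n. norm (pulse k z)) \<le>
      pulse_bound \<bar>Im z\<bar> * exp (- 64 * (Re z - 4 ^ 0 * of_int (round (Re z)))\<^sup>2)"
    by auto
qed auto

lemma norm_pulse_sum_tail_le:
  assumes "\<bar>Im z\<bar> \<le> Y" "\<bar>Re z - 4 ^ K * of_int j\<bar> \<le> 4 ^ K / 2"
  shows "norm (pulse_sum z - (\<Sum>k<K. pulse k z)) \<le>
    pulse_bound Y * exp (- 64 * (Re z - 4 ^ K * of_int j)\<^sup>2)"
proof -
  have s: "summable (\<lambda>k. norm (pulse (k + K) z))"
    using summable_norm_pulse by (rule summable_ignore_initial_segment)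
  have "pulse_sum z - (\<Sum>k<K. pulse k z) = (\<Sum>k. pulse (k + K) z)"
    unfolding pulse_sum_def
    using summable_norm_cancel [OF summable_norm_pulse] by (rule suminf_minus_initial_segment [symmetric])
  also have "norm \<dots> \<le> (\<Sum>k. norm (pulse (k + K) z))"
    using s by (rule summable_norm)
  also have "\<dots> \<le> pulse_bound Y * exp (- 64 * (Re z - 4 ^ K * of_int j)\<^sup>2)"
  proof (rule suminf_le_const [OF s])
    fix n
    have "(\<Sum>k<n. norm (pulse (k + K) z)) = (\<Sum>k\<in>(\<lambda>k. k + K) ` {..<n}. norm (pulse k z))"
      by (simp add: sum.reindex)
    also have "\<dots> \<le> pulse_bound Y * exp (- 64 * (Re z - 4 ^ K * of_int j)\<^sup>2)"
      using assms by (intro sum_norm_pulse_le) auto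
    finally show "(\<Sum>k<n. norm (pulse (k + K) z)) \<le>
      pulse_bound Y * exp (- 64 * (Re z - 4 ^ K * of_int j)\<^sup>2)" .
  qed
  finally show ?thesis .
qed

text \<open>On a bounded set the argument of the sine tends to 0 as \<open>k\<close> grows, so
  eventually \<open>|sin w|^2 <= 1/2\<close>; the large exponents then give uniform convergence by
  the Weierstrass test.\<close>

lemma holomorphic_pulse_sum: "pulse_sum holomorphic_on UNIV"
proof (rule holomorphic_uniform_sequence)
  show "(\<lambda>z. \<Sum>k<n. pulse k z) holomorphic_on UNIV" for n
    unfolding pulse_def by (intro holomorphic_intros) auto
  fix x :: complex
  define R where "R = norm x + 1"
  have "uniform_limit (cball x 1) (\<lambda>n z. \<Sum>k<n. pulse k z) (\<lambda>z. \<Sum>k. pulse k z) sequentially"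
  proof (rule Weierstrass_m_test_ev)
    show "summable (\<lambda>k. (1 / 2 :: real) ^ k)"
      by (simp add: summable_geometric)
    obtain N where N: "2 * pi * R < 4 ^ N"
      using real_arch_pow [of 4 "2 * pi * R"] by auto
    have "2 * pi * R \<le> 4 ^ k" if "N \<le> k" for k
    proof -
      have "(4 :: real) ^ N \<le> 4 ^ k" using that by simp
      with N show ?thesis by linarith
    qed
    then have "eventually (\<lambda>k. 2 * pi * R \<le> 4 ^ k) sequentially"
      by (rule eventually_sequentiallyI)
    then show "\<forall>\<^sub>F k in sequentially. \<forall>z\<in>cball x 1. norm (pulse k z) \<le> (1 / 2) ^ k"
    proof (rule eventually_mono, intro ballI)
      fix k z assume k: "2 * pi * R \<le> 4 ^ k" and z: "z \<in> cball x 1"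
      have zR: "norm z \<le> R"
        using z norm_triangle_sub [of z x] by (simp add: R_def dist_norm norm_minus_commute)
      define w where "w = of_real pi * z / (2 * 4 ^ k)"
      have "norm w = pi * norm z / (2 * 4 ^ k)"
        by (simp add: w_def norm_mult norm_divide norm_power)
      also have "\<dots> \<le> 1 / 4"
      proof -
        have "2 * pi * norm z \<le> 2 * pi * R"
          using zR by (intro mult_left_mono) auto
        then have "2 * pi * norm z \<le> 4 ^ k"
          using k by linarith
        then show ?thesis
          by (simp add: field_simps)
      qed
      finally have w: "norm w \<le> 1 / 4" .
      have "\<bar>sin (Re w)\<bar> \<le> 1 / 4"
        using abs_sin_x_le_abs_x [of "Re w"] abs_Re_le_cmod [of w] w by linarith
      then have 1: "(sin (Re w))\<^sup>2 \<le> (1 / 4)\<^sup>2"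
        using power_mono [of "\<bar>sin (Re w)\<bar>" "1 / 4" 2] by simp
      have "sinh \<bar>Im w\<bar> \<le> \<bar>Im w\<bar> * exp \<bar>Im w\<bar>"
        by (rule sinh_le_mult_exp)
      also have "\<dots> \<le> 1 / 4 * 2"
      proof (rule mult_mono)
        show "\<bar>Im w\<bar> \<le> 1 / 4"
          using abs_Im_le_cmod [of w] w by linarith
        then have "exp \<bar>Im w\<bar> \<le> 1 + 2 * \<bar>Im w\<bar>"
          using exp_bound_lemma [of "\<bar>Im w\<bar>"] by simp
        then show "exp \<bar>Im w\<bar> \<le> 2"
          using \<open>\<bar>Im w\<bar> \<le> 1 / 4\<close> by linarith
      qed auto
      finally have "(sinh \<bar>Im w\<bar>)\<^sup>2 \<le> (1 / 2)\<^sup>2"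
        by (intro power_mono) auto
      moreover have "(sinh \<bar>Im w\<bar>)\<^sup>2 = (sinh (Im w))\<^sup>2"
        by (simp add: abs_if)
      ultimately have 2: "(norm (sin w))\<^sup>2 \<le> 1 / 2"
        using 1 by (simp add: norm_sin_squared_sinh power_divide)
      have "norm (pulse k z) = ((norm (sin w))\<^sup>2) ^ (128 * 16 ^ k)"
        by (simp add: pulse_def w_def norm_power flip: power_mult)
      also have "\<dots> \<le> (1 / 2) ^ (128 * 16 ^ k)"
        using 2 by (intro power_mono) auto
      also have "\<dots> \<le> (1 / 2) ^ k"
      proof (rule power_decreasing)
        show "k \<le> 128 * 16 ^ k"
          using less_exp [of k] power_mono [of "2 :: nat" 16 k] by linarith
      qed auto
      finally show "norm (pulse k z) \<le> (1 / 2) ^ k" .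
    qed
  qed
  then show "\<exists>d>0. cball x d \<subseteq> UNIV \<and>
      uniform_limit (cball x d) (\<lambda>n z. \<Sum>k<n. pulse k z) pulse_sum sequentially"
    unfolding pulse_sum_def [abs_def] by (intro exI [of _ 1]) auto
qed auto

subsection \<open>Approximation in the Weyl distance\<close>

text \<open>The two lists of coefficients and frequencies are concatenated, the second one shifted
  by \<open>M\<close>.\<close>

lemma finite_exp_sum_add:
  assumes "finite_exp_sum \<alpha> \<beta> P" "finite_exp_sum \<alpha> \<beta> Q"
  shows "finite_exp_sum \<alpha> \<beta> (\<lambda>z. P z + Q z)"
proof -
  obtain M :: nat and c l where P: "\<forall>n\<in>{1..M}. continuous_on {\<alpha>..\<beta>} (c n)"
    "\<forall>z\<in>strip \<alpha> \<beta>. P z = (\<Sum>n=1..M. c n (Im z) * exp (\<i> * of_real (l n * Re z)))"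
    using assms(1) unfolding finite_exp_sum_def by blast
  obtain N :: nat and d m where Q: "\<forall>n\<in>{1..N}. continuous_on {\<alpha>..\<beta>} (d n)"
    "\<forall>z\<in>strip \<alpha> \<beta>. Q z = (\<Sum>n=1..N. d n (Im z) * exp (\<i> * of_real (m n * Re z)))"
    using assms(2) unfolding finite_exp_sum_def by blast
  define e where "e n = (if n \<le> M then c n else d (n - M))" for n
  define p where "p n = (if n \<le> M then l n else m (n - M))" for n
  have "continuous_on {\<alpha>..\<beta>} (e n)" if "n \<in> {1..M + N}" for n
  proof (cases "n \<le> M")
    case False
    then have "n - M \<in> {1..N}" using that by auto
    with Q(1) False show ?thesis by (auto simp: e_def)
  qed (use that P(1) in \<open>auto simp: e_def\<close>)
  moreover have "P z + Q z = (\<Sum>n=1..M + N. e n (Im z) * exp (\<i> * of_real (p n * Re z)))"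
    if z: "z \<in> strip \<alpha> \<beta>" for z
  proof -
    have "(\<Sum>n=1..M + N. e n (Im z) * exp (\<i> * of_real (p n * Re z))) =
        (\<Sum>n=1..M. e n (Im z) * exp (\<i> * of_real (p n * Re z))) +
        (\<Sum>n=1+M..N+M. e n (Im z) * exp (\<i> * of_real (p n * Re z)))"
      by (subst sum.ub_add_nat) (auto simp: add.commute)
    also have "(\<Sum>n=1+M..N+M. e n (Im z) * exp (\<i> * of_real (p n * Re z))) = Q z"
      unfolding Q(2) [rule_format, OF z] sum.shift_bounds_cl_nat_ivl by (auto intro!: sum.cong simp: e_def p_def)
    also have "(\<Sum>n=1..M. e n (Im z) * exp (\<i> * of_real (p n * Re z))) = P z"
      unfolding P(2) [rule_format, OF z] by (auto intro!: sum.cong simp: e_def p_def)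
    finally show ?thesis by simp
  qed
  ultimately show ?thesis
    unfolding finite_exp_sum_def by blast
qed

lemma finite_exp_sum_zero: "finite_exp_sum \<alpha> \<beta> (\<lambda>z. 0)"
  unfolding finite_exp_sum_def by (intro exI [of _ 0]) auto

lemma finite_exp_sum_sum:
  assumes "\<And>k. k \<in> A \<Longrightarrow> finite_exp_sum \<alpha> \<beta> (P k)"
  shows "finite_exp_sum \<alpha> \<beta> (\<lambda>z. \<Sum>k\<in>A. P k z)"
  using assms
  by (induction A rule: infinite_finite_induct)
    (simp_all add: finite_exp_sum_zero finite_exp_sum_add)

text \<open>The factor \<open>exp (- l * Im z)\<close> is absorbed into the coefficient, which may
  depend continuously on the imaginary part.\<close>

lemma finite_exp_sum_exp: "finite_exp_sum \<alpha> \<beta> (\<lambda>z. a * exp (\<i> * of_real l * z))"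
proof -
  have "a * exp (\<i> * of_real l * z) =
      a * of_real (exp (- l * Im z)) * exp (\<i> * of_real (l * Re z))" for z
  proof -
    have "\<i> * of_real l * z = of_real (- l * Im z) + \<i> * of_real (l * Re z)"
      by (simp add: complex_eq_iff)
    then show ?thesis
      by (simp only: exp_add exp_of_real mult.assoc)
  qed
  then show ?thesis
    unfolding finite_exp_sum_def
    by (intro exI [of _ 1] exI [of _ "\<lambda>n y. a * of_real (exp (- l * y))"] exI [of _ "\<lambda>n. l"])
      (auto intro!: continuous_intros)
qed

text \<open>Binomial expansion of \<open>((exp w - exp (- w)) / (2 * \<i>))^n\<close> with
  \<open>w = \<i> * l * z\<close>.\<close>

lemma finite_exp_sum_sin_power:
  "finite_exp_sum \<alpha> \<beta> (\<lambda>z. sin (of_real l * z) ^ n)"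
proof -
  have "sin (of_real l * z) ^ n =
    (\<Sum>k\<le>n. (of_nat (n choose k) * (- 1) ^ (n - k) / (2 * \<i>) ^ n) *
        exp (\<i> * of_real (l * (real k - real (n - k))) * z))" for z
  proof -
    define w where "w = \<i> * (of_real l * z)"
    have "sin (of_real l * z) = (exp w + - exp (- w)) / (2 * \<i>)"
      by (simp add: sin_exp_eq w_def)
    then have "sin (of_real l * z) ^ n = (exp w + - exp (- w)) ^ n / (2 * \<i>) ^ n"
      by (simp only: power_divide)
    also have "(exp w + - exp (- w)) ^ n =
        (\<Sum>k\<le>n. of_nat (n choose k) * exp w ^ k * (- exp (- w)) ^ (n - k))"
      by (rule binomial_ring)
    also have "\<dots> = (\<Sum>k\<le>n. of_nat (n choose k) * (- 1) ^ (n - k) *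
        exp (\<i> * of_real (l * (real k - real (n - k))) * z))"
    proof (rule sum.cong)
      fix k
      have "exp w ^ k * exp (- w) ^ (n - k) = exp (of_nat k * w + of_nat (n - k) * (- w))"
        by (simp only: exp_add exp_of_nat_mult)
      also have "of_nat k * w + of_nat (n - k) * (- w) =
          \<i> * of_real (l * (real k - real (n - k))) * z"
        by (simp add: w_def algebra_simps)
      finally show "of_nat (n choose k) * exp w ^ k * (- exp (- w)) ^ (n - k) =
          of_nat (n choose k) * (- 1) ^ (n - k) *
          exp (\<i> * of_real (l * (real k - real (n - k))) * z)"
        by (simp add: power_minus [of "exp (- w)"] mult_ac)
    qed simp
    finally show ?thesis
      by (simp add: sum_divide_distrib)
  qed
  then show ?thesis
    using finite_exp_sum_sum [of "{..n}", OF finite_exp_sum_exp] by presburger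
qed

lemma finite_exp_sum_pulse: "finite_exp_sum \<alpha> \<beta> (pulse k)"
proof -
  have "pulse k = (\<lambda>z. sin (of_real (pi / (2 * 4 ^ k)) * z) ^ (256 * 16 ^ k))"
    by (simp add: pulse_def fun_eq_iff)
  then show ?thesis
    using finite_exp_sum_sin_power by presburger
qed

section \<open>Integrals of functions with periodically placed bumps\<close>

lemma integral_windows_le:
  fixes h :: "real \<Rightarrow> real"
  assumes "continuous_on UNIV h" "0 < q"
    and le: "\<And>i. i < N \<Longrightarrow> integral {s + q * real i..s + q * real (Suc i)} h \<le> c"
  shows "integral {s..s + q * real N} h \<le> real N * c"
  using le
proof (induction N)
  case (Suc N)
  have "integral {s..s + q * real (Suc N)} h =
      integral {s..s + q * real N} h + integral {s + q * real N..s + q * real (Suc N)} h"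
    using assms(1,2)
    by (intro Henstock_Kurzweil_Integration.integral_combine [symmetric] integrable_continuous_real continuous_on_subset [OF assms(1)])
      (auto simp: algebra_simps)
  also have "\<dots> \<le> real N * c + c"
    using Suc by (intro add_mono) auto
  finally show ?case
    by (simp add: algebra_simps)
qed auto

text \<open>The majorant has the antiderivative \<open>C * arctan (t - m)\<close>, whose total
  variation is \<open>C * pi\<close>.\<close>

lemma integral_bump_le:
  fixes h :: "real \<Rightarrow> real"
  assumes "continuous_on {a..b} h" "0 \<le> C"
    and le: "\<And>t. t \<in> {a..b} \<Longrightarrow> h t \<le> C / (1 + (t - m)\<^sup>2)"
  shows "integral {a..b} h \<le> C * pi"
proof (cases "a \<le> b")
  case True
  have "((\<lambda>t. C / (1 + (t - m)\<^sup>2)) has_integral C * arctan (b - m) - C * arctan (a - m)) {a..b}"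
    using True
    by (intro fundamental_theorem_of_calculus)
      (auto intro!: derivative_eq_intros simp: divide_inverse
        simp flip: has_real_derivative_iff_has_vector_derivative)
  then have "integral {a..b} h \<le> C * arctan (b - m) - C * arctan (a - m)"
    using integrable_continuous_real [OF assms(1)] le
    by (intro has_integral_le [OF integrable_integral]) auto
  also have "\<dots> = C * (arctan (b - m) - arctan (a - m))"
    by (simp add: algebra_simps)
  also have "\<dots> \<le> C * pi"
    using arctan_bounded [of "b - m"] arctan_bounded [of "a - m"] assms(2)
    by (intro mult_left_mono) auto
  finally show ?thesis .
qed (use assms in auto)

text \<open>\<open>{-T..T}\<close> is covered by at most \<open>2 * T / q + 2\<close> windows of
  length \<open>q\<close>, each centred at a bump and contributing at most \<open>C * pi\<close>.
  The bound does not involve \<open>x\<close>, as the supremum over the strip requires.\<close>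

lemma integral_periodic_bumps_le:
  fixes h :: "real \<Rightarrow> real"
  assumes cont: "continuous_on UNIV h" and nonneg: "\<And>t. 0 \<le> h t" and "0 < q" "0 \<le> C"
    and le: "\<And>t j. \<bar>x + t - q * of_int j\<bar> \<le> q / 2 \<Longrightarrow> h t \<le> C / (1 + (x + t - q * of_int j)\<^sup>2)"
    and "0 \<le> T"
  shows "integral {-T..T} h \<le> (2 * T / q + 2) * (C * pi)"
proof -
  \<comment> \<open>The window of index \<open>j\<close> contains \<open>-T\<close>, and
    \<open>s\<close> is its left end. One window more than \<open>2 * T / q\<close> rounded up
    compensates for the overhang to the left of \<open>-T\<close>.\<close>
  define j where "j = \<lfloor>(x - T) / q + 1 / 2\<rfloor>"
  define s where "s = q * (of_int j - 1 / 2) - x"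
  define N where "N = nat \<lceil>2 * T / q\<rceil> + 1"
  have "of_int j \<le> (x - T) / q + 1 / 2" "(x - T) / q + 1 / 2 < of_int j + 1"
    by (simp_all add: j_def)
  then have s: "s \<le> - T" "- T - q \<le> s"
    using assms(3) by (simp_all add: s_def field_simps)
  have "real N = of_int \<lceil>2 * T / q\<rceil> + 1"
    using assms(3,6) by (simp add: N_def)
  then have N: "2 * T / q + 1 \<le> real N" "real N \<le> 2 * T / q + 2"
    by linarith+
  have "2 * T + q \<le> q * real N"
    using N(1) assms(3) by (simp add: field_simps)
  then have "integral {-T..T} h \<le> integral {s..s + q * real N} h"
    using s nonneg
    by (intro integral_subset_le integrable_continuous_real continuous_on_subset [OF cont]) auto
  also have "\<dots> \<le> real N * (C * pi)"
  proof (rule integral_windows_le [OF cont assms(3)])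
    fix i
    show "integral {s + q * real i..s + q * real (Suc i)} h \<le> C * pi"
    proof (rule integral_bump_le)
      fix t assume t: "t \<in> {s + q * real i..s + q * real (Suc i)}"
      have "\<bar>x + t - q * of_int (j + int i)\<bar> \<le> q / 2"
        using t by (intro abs_leI) (auto simp: s_def algebra_simps)
      from le [OF this] show "h t \<le> C / (1 + (t - (q * of_int (j + int i) - x))\<^sup>2)"
        by (simp add: algebra_simps)
    qed (use cont assms(4) in \<open>auto intro: continuous_on_subset\<close>)
  qed
  also have "\<dots> \<le> (2 * T / q + 2) * (C * pi)"
    using N(2) assms(4) by (intro mult_right_mono) auto
  finally show ?thesis .
qed

lemma continuous_on_pulse_sum: "continuous_on A pulse_sum"
  using holomorphic_on_imp_continuous_on [OF holomorphic_pulse_sum] continuous_on_subset by blast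

lemma weyl_admissible_pulse_sum: "weyl_admissible \<alpha> \<beta> pulse_sum"
proof -
  have "closed (strip \<alpha> \<beta>)"
    unfolding strip_def by (intro closed_Collect_conj closed_Collect_le continuous_intros)
  then have "strip \<alpha> \<beta> \<in> sets lebesgue"
    by (intro lebesgue_closedin [of UNIV, simplified])
  moreover have "continuous_on {a..b} (\<lambda>x. pulse_sum (Complex x y))" for a b y
    by (intro continuous_on_compose2 [OF continuous_on_pulse_sum [of UNIV]])
      (auto simp: Complex_eq intro!: continuous_intros)
  ultimately show ?thesis
    unfolding weyl_admissible_def
    by (auto intro!: continuous_imp_measurable_on_sets_lebesgue continuous_on_pulse_sum
        absolutely_integrable_continuous_real)
qed

text \<open>The tail has one bump of bounded integral per period \<open>4^K\<close>, so its mean is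
  of order \<open>1 / 4^K\<close>, uniformly on the strip. Taking \<open>T >= 4^K\<close> lets the
  two extra windows be absorbed into the main term.\<close>

lemma weyl_dist_pulse_sum_le:
  assumes Y: "\<bar>\<alpha>\<bar> \<le> Y" "\<bar>\<beta>\<bar> \<le> Y"
  shows "weyl_dist \<alpha> \<beta> pulse_sum (\<lambda>z. \<Sum>k<K. pulse k z) \<le> ereal (2 * pulse_bound Y * pi / 4 ^ K)"
  unfolding weyl_dist_def
proof (rule Limsup_bounded)
  have "eventually (\<lambda>T. (4 :: real) ^ K \<le> T) at_top"
    by (rule eventually_ge_at_top)
  then show "\<forall>\<^sub>F T in at_top. (SUP z\<in>strip \<alpha> \<beta>. ereal (1 / (2 * T) * integral {- T..T}
      (\<lambda>t. norm (pulse_sum (z + of_real t) - (\<Sum>k<K. pulse k (z + of_real t))))))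
      \<le> ereal (2 * pulse_bound Y * pi / 4 ^ K)"
  proof (rule eventually_mono, intro SUP_least)
    fix T :: real and z assume T: "4 ^ K \<le> T" and z: "z \<in> strip \<alpha> \<beta>"
    have T0: "0 < T" using T by (rule less_le_trans [rotated]) simp
    define C where "C = pulse_bound Y"
    have C: "0 < C" by (simp add: C_def pulse_bound_pos)
    define h where "h t = norm (pulse_sum (z + of_real t) - (\<Sum>k<K. pulse k (z + of_real t)))" for t
    have "continuous_on UNIV h"
      unfolding h_def pulse_def
      by (intro continuous_intros continuous_on_compose2 [OF continuous_on_pulse_sum [of UNIV]]) auto
    moreover have "h t \<le> C / (1 + (Re z + t - 4 ^ K * of_int j)\<^sup>2)"
      if "\<bar>Re z + t - 4 ^ K * of_int j\<bar> \<le> 4 ^ K / 2" for t j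
    proof -
      define u where "u = (Re z + t - 4 ^ K * of_int j)\<^sup>2"
      have "h t \<le> C * exp (- 64 * u)"
        unfolding h_def C_def u_def
        using norm_pulse_sum_tail_le [of "z + of_real t" Y K j] that z Y by (auto simp: strip_def)
      also have "\<dots> \<le> C * (1 / (1 + u))"
      proof (rule mult_left_mono)
        have "1 + u \<le> exp u" by (rule exp_ge_add_one_self)
        also have "\<dots> \<le> exp (64 * u)" by (simp add: u_def)
        finally show "exp (- 64 * u) \<le> 1 / (1 + u)"
          by (simp add: exp_minus u_def field_simps add_pos_nonneg)
      qed (use C in simp)
      finally show ?thesis by (simp add: u_def)
    qed
    ultimately have "integral {-T..T} h \<le> (2 * T / 4 ^ K + 2) * (C * pi)"
      using C T0 by (intro integral_periodic_bumps_le [where x = "Re z"]) (auto simp: h_def)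
    also have "\<dots> \<le> (2 * T / 4 ^ K + 2 * T / 4 ^ K) * (C * pi)"
      using C T by (intro mult_right_mono) (auto simp: field_simps)
    finally have "1 / (2 * T) * integral {-T..T} h \<le> 1 / (2 * T) * ((2 * T / 4 ^ K + 2 * T / 4 ^ K) * (C * pi))"
      using T0 by (intro mult_left_mono) auto
    also have "\<dots> = 2 * C * pi / 4 ^ K"
      using T0 by (simp add: field_simps)
    finally show "ereal (1 / (2 * T) * integral {- T..T}
      (\<lambda>t. norm (pulse_sum (z + of_real t) - (\<Sum>k<K. pulse k (z + of_real t)))))
      \<le> ereal (2 * pulse_bound Y * pi / 4 ^ K)"
      by (simp add: h_def [abs_def] C_def)
  qed
qed

lemma pulse_sum_in_HW1_entire: "pulse_sum \<in> HW1_entire"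
proof -
  have "\<exists>Q. finite_exp_sum \<alpha> \<beta> Q \<and> weyl_dist \<alpha> \<beta> pulse_sum Q < ereal \<epsilon>" if "0 < \<epsilon>" for \<alpha> \<beta> \<epsilon> :: real
  proof -
    define C where "C = 2 * pulse_bound (max \<bar>\<alpha>\<bar> \<bar>\<beta>\<bar>) * pi"
    obtain K where "C / \<epsilon> < 4 ^ K"
      using real_arch_pow [of 4] by auto
    then have "C / 4 ^ K < \<epsilon>"
      using that by (simp add: field_simps)
    moreover have "weyl_dist \<alpha> \<beta> pulse_sum (\<lambda>z. \<Sum>k<K. pulse k z) \<le> ereal (C / 4 ^ K)"
      unfolding C_def by (rule weyl_dist_pulse_sum_le) auto
    ultimately have "weyl_dist \<alpha> \<beta> pulse_sum (\<lambda>z. \<Sum>k<K. pulse k z) < ereal \<epsilon>"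
      by (simp add: le_less_trans)
    moreover have "finite_exp_sum \<alpha> \<beta> (\<lambda>z. \<Sum>k<K. pulse k z)"
      by (intro finite_exp_sum_sum finite_exp_sum_pulse)
    ultimately show ?thesis
      by (intro exI conjI)
  qed
  then show ?thesis
    by (simp add: HW1_entire_def W1_def holomorphic_pulse_sum weyl_admissible_pulse_sum)
qed

subsection \<open>Failure of almost periodicity\<close>

text \<open>On the real line \<open>norm_pulse_le\<close> holds with \<open>Y = 0\<close>, where its
  constant is 1, and the peaks of different levels are distinct integers in
  \<open>centres\<close>.\<close>

lemma norm_pulse_sum_far_le:
  assumes far: "\<And>n. n \<in> centres \<Longrightarrow> 1 / 4 \<le> \<bar>x - of_int n\<bar>"
  shows "norm (pulse_sum (of_real x)) \<le> 2 / 15"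
proof -
  have "norm (pulse_sum (of_real x)) \<le> (\<Sum>k. norm (pulse k (of_real x)))"
    unfolding pulse_sum_def using summable_norm_pulse by (rule summable_norm)
  also have "\<dots> \<le> 2 / 15"
  proof (rule suminf_le_const [OF summable_norm_pulse])
    fix K
    have "norm (pulse k (of_real x)) \<le> exp (- 64 * (x - of_int (centre k x))\<^sup>2)" for k
      using norm_pulse_le [of "of_real x" 0 k] by simp
    then have "(\<Sum>k<K. norm (pulse k (of_real x))) \<le>
        (\<Sum>k<K. exp (- 64 * (x - of_int (centre k x))\<^sup>2))"
      by (intro sum_mono)
    also have "\<dots> \<le> 2 / 15"
      by (intro sum_gauss_far_le far centre_in_centres) (auto simp: inj_on_def dest: centre_inject)
    finally show "(\<Sum>k<K. norm (pulse k (of_real x))) \<le> 2 / 15" .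
  qed
  finally show ?thesis .
qed

text \<open>By nonnegativity on the real line, the single pulse peaking at \<open>n\<close> bounds
  the whole sum from below.\<close>

lemma norm_pulse_sum_near_ge:
  assumes "n \<in> centres" "\<bar>t\<bar> \<le> 1 / 40"
  shows "68 / 100 \<le> norm (pulse_sum (of_real (of_int n + t)))"
proof -
  obtain k i where n: "n = 4 ^ k * (2 * i + 1)"
    using assms(1) by (auto simp: centres_def)
  define x where "x = of_int n + t"
  have s: "summable (\<lambda>k. pulse k (of_real x))"
    using summable_norm_cancel [OF summable_norm_pulse] .
  have "68 / 100 \<le> (\<Sum>k\<in>{k}. Re (pulse k (of_real x)))"
    using Re_pulse_of_real_ge [OF assms(2), of k i] by (simp add: x_def n)
  also have "\<dots> \<le> (\<Sum>k. Re (pulse k (of_real x)))"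
    using summable_Re [OF s] by (intro sum_le_suminf) (auto simp: pulse_of_real_nonneg)
  also have "\<dots> = Re (pulse_sum (of_real x))"
    unfolding pulse_sum_def using s by (rule Re_suminf [symmetric])
  also have "\<dots> \<le> norm (pulse_sum (of_real x))"
    by (rule complex_Re_le_cmod)
  finally show ?thesis by (simp add: x_def)
qed

section \<open>Integers of even and odd 2-adic valuation\<close>

text \<open>These numbers have odd 2-adic valuation; cancelling powers of 4 in an equality with a
  centre leaves an odd number equal to an even one.\<close>

lemma double_not_in_centres: "2 * 4 ^ k * (2 * i + 1) \<notin> centres"
proof
  assume "2 * 4 ^ k * (2 * i + 1) \<in> centres"
  then obtain j b where eq: "2 * (4 ^ k * (2 * i + 1)) = 4 ^ j * (2 * b + 1)"
    by (auto simp: centres_def mult.assoc)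
  have "k < j"
  proof (rule ccontr)
    assume "\<not> k < j"
    then obtain d where "k = j + d" using le_Suc_ex not_less by blast
    then have "2 * (4 ^ d * (2 * i + 1)) = 2 * b + 1"
      using eq by (simp add: power_add mult.assoc)
    then show False by presburger
  qed
  then obtain d where "j = Suc (k + d)" using less_imp_Suc_add by blast
  then have "2 * i + 1 = 2 * (4 ^ d * (2 * b + 1))"
    using eq by (simp add: power_add mult.assoc)
  then show False by presburger
qed

lemma exists_pow4_odd:
  fixes m :: int
  assumes "0 < m"
  shows "\<exists>k i. m = 4 ^ k * (2 * i + 1) \<or> m = 2 * 4 ^ k * (2 * i + 1)"
  using assms
proof (induction "nat m" arbitrary: m rule: less_induct)
  case less
  have "m mod 4 = 0 \<or> m mod 4 = 2 \<or> m mod 2 = 1" by presburger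
  then consider "m mod 4 = 0" | "m mod 4 = 2" | "m mod 2 = 1" by blast
  then show ?case
  proof cases
    case 1
    then obtain l where l: "m = 4 * l" by auto
    then obtain k i where "l = 4 ^ k * (2 * i + 1) \<or> l = 2 * 4 ^ k * (2 * i + 1)"
      using less.hyps [of l] less.prems by auto
    then show ?thesis
      by (intro exI [of _ "Suc k"] exI [of _ i]) (auto simp: l)
  next
    case 2
    then have "m = 2 * 4 ^ 0 * (2 * (m div 4) + 1)"
      unfolding power_0 by presburger
    then show ?thesis by blast
  next
    case 3
    then have "m = 4 ^ 0 * (2 * (m div 2) + 1)"
      unfolding power_0 by presburger
    then show ?thesis by blast
  qed
qed

text \<open>The set of centres has no almost period: if the 2-adic valuation of \<open>m\<close> is \<open>v\<close>,
  the progression consists of numbers whose valuations are \<open>v\<close> and \<open>v + 1\<close> before and after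
  the shift by \<open>m\<close>, or conversely, according to the parity of \<open>v\<close>.\<close>

lemma centres_progression:
  assumes "0 < m"
  shows "\<exists>q>0. \<exists>n. \<forall>i. n + q * i \<in> centres \<and> n + q * i + m \<notin> centres"
proof -
  obtain k l where "m = 4 ^ k * (2 * l + 1) \<or> m = 2 * 4 ^ k * (2 * l + 1)"
    using exists_pow4_odd [OF assms] by blast
  then show ?thesis
  proof
    assume m: "m = 4 ^ k * (2 * l + 1)"
    show ?thesis
    proof (intro exI conjI allI)
      \<comment> \<open>Here \<open>q = 4^(k+1)\<close> and \<open>n = 2 * 4^k - m\<close>: the
        shift by \<open>m\<close> lands on odd multiples of \<open>2 * 4^k\<close>, while
        \<open>n + q * i\<close> remains an odd multiple of \<open>4^k\<close>.\<close>
      show "(0 :: int) < 4 ^ Suc k" by simp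
      fix i :: int
      have "2 * 4 ^ k - m + 4 ^ Suc k * i = 4 ^ k * (2 * (2 * i - l) + 1)"
        by (simp add: m algebra_simps)
      then show "2 * 4 ^ k - m + 4 ^ Suc k * i \<in> centres"
        unfolding centres_def by blast
      have "2 * 4 ^ k - m + 4 ^ Suc k * i + m = 2 * 4 ^ k * (2 * i + 1)"
        by (simp add: algebra_simps)
      then show "2 * 4 ^ k - m + 4 ^ Suc k * i + m \<notin> centres"
        by (simp only: double_not_in_centres not_False_eq_True)
    qed
  next
    assume m: "m = 2 * 4 ^ k * (2 * l + 1)"
    show ?thesis
    proof (intro exI conjI allI)
      \<comment> \<open>Here \<open>n = 4^(k+1)\<close> and \<open>q = 2 * 4^(k+1)\<close>: the
        progression consists of odd multiples of \<open>4^(k+1)\<close>, and adding \<open>m\<close>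
        lowers the valuation to that of \<open>m\<close>.\<close>
      show "(0 :: int) < 2 * 4 ^ Suc k" by simp
      fix i :: int
      have "4 ^ Suc k + 2 * 4 ^ Suc k * i = 4 ^ Suc k * (2 * i + 1)"
        by (simp add: algebra_simps)
      then show "4 ^ Suc k + 2 * 4 ^ Suc k * i \<in> centres"
        unfolding centres_def by blast
      have "4 ^ Suc k + 2 * 4 ^ Suc k * i + m = 2 * 4 ^ k * (2 * (1 + 2 * i + l) + 1)"
        by (simp add: m algebra_simps)
      then show "4 ^ Suc k + 2 * 4 ^ Suc k * i + m \<notin> centres"
        by (simp only: double_not_in_centres not_False_eq_True)
    qed
  qed
qed

section \<open>A mean lower bound and the contradiction\<close>

lemma integral_windows_ge:
  fixes u :: "real \<Rightarrow> real"
  assumes cont: "continuous_on UNIV u" and nonneg: "\<And>t. 0 \<le> u t" and "0 \<le> w" "w \<le> q" "0 < q"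
    and ge: "\<And>i t. i < N \<Longrightarrow> t \<in> {s + q * real i..s + q * real i + w} \<Longrightarrow> \<delta> \<le> u t"
  shows "real N * (w * \<delta>) \<le> integral {s..s + q * real N} u"
proof -
  have int: "u integrable_on {a..b}" for a b
    by (intro integrable_continuous_real continuous_on_subset [OF cont]) auto
  have "integral {s..s + q * real N} (\<lambda>t. - u t) \<le> real N * (- (w * \<delta>))"
  proof (rule integral_windows_le)
    show "continuous_on UNIV (\<lambda>t. - u t)"
      using cont by (intro continuous_intros)
    fix i assume i: "i < N"
    have "w * \<delta> = integral {s + q * real i..s + q * real i + w} (\<lambda>t. \<delta>)"
      using assms(3) by simp
    also have "\<dots> \<le> integral {s + q * real i..s + q * real i + w} u"
      using int ge [OF i] by (intro integral_le) auto
    also have "\<dots> \<le> integral {s + q * real i..s + q * real (Suc i)} u"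
      using int nonneg assms(4) by (intro integral_subset_le) (auto simp: algebra_simps)
    finally show "integral {s + q * real i..s + q * real (Suc i)} (\<lambda>t. - u t) \<le> - (w * \<delta>)"
      by simp
  qed (use assms in auto)
  then show ?thesis by simp
qed

theorem theorem2:
  shows "\<exists>f\<in>HW1_entire. \<forall>H>0. \<forall>g. HW1_equivalent (- H) H f g \<longrightarrow> g \<notin> HU (- H) H"
proof (intro bexI allI impI)
  show "pulse_sum \<in> HW1_entire"
    by (rule pulse_sum_in_HW1_entire)
  fix H :: real and g
  assume H: "0 < H" and "HW1_equivalent (- H) H pulse_sum g"
  then have dist0: "weyl_dist (- H) H pulse_sum g = 0"
    by (simp add: HW1_equivalent_def)
  have line: "complex_of_real x \<in> strip (- H) H" for x
    using H by (simp add: strip_def)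
  show "g \<notin> HU (- H) H"
  proof
    assume "g \<in> HU (- H) H"
    then have cont_g: "continuous_on (strip (- H) H) g"
      and ap: "relatively_dense
        {\<tau>. (SUP z\<in>strip (- H) H. ereal (norm (g (z + of_real \<tau>) - g z))) < ereal (1 / 4)}"
      unfolding HU_def almost_periodic_def by auto
    \<comment> \<open>Relative density is applied to a segment starting at 1, so that
      \<open>\<tau>\<close> rounds to a positive integer.\<close>
    obtain \<tau> where \<tau>: "1 \<le> \<tau>"
      and sup: "(SUP z\<in>strip (- H) H. ereal (norm (g (z + of_real \<tau>) - g z))) < ereal (1 / 4)"
      using ap unfolding relatively_dense_def by fastforce
    have period: "norm (g (of_real (x + \<tau>)) - g (of_real x)) < 1 / 4" for x
      using le_less_trans [OF SUP_upper [OF line [of x]] sup] by simp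
    define m where "m = round \<tau>"
    have m_near: "\<bar>of_int m - \<tau>\<bar> \<le> 1 / 2"
      unfolding m_def by (rule of_int_round_abs_le)
    then have "0 < m" using \<tau> by linarith
    then obtain q n where q: "0 < q"
      and nm: "\<forall>i. n + q * i \<in> centres \<and> n + q * i + m \<notin> centres"
      using centres_progression by blast
    define h where "h x = norm (pulse_sum (of_real x) - g (of_real x))" for x :: real
    have cont_h: "continuous_on UNIV h"
      unfolding h_def
      by (intro continuous_intros continuous_on_compose2 [OF continuous_on_pulse_sum [of UNIV]]
          continuous_on_compose2 [OF cont_g]) (use line in auto)
    have h_ge: "1 / 4 \<le> h (of_int (n + q * i) + t) + h (of_int (n + q * i) + t + \<tau>)"
      if t: "\<bar>t\<bar> \<le> 1 / 40" for i t
    proof -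
      define x where "x = of_int (n + q * i) + t"
      have "norm (pulse_sum (of_real (x + \<tau>))) \<le> 2 / 15"
      proof (rule norm_pulse_sum_far_le)
        fix c assume "c \<in> centres"
        then have "c \<noteq> n + q * i + m" using nm by metis
        \<comment> \<open>Every centre is at least 1 away from \<open>n + q * i + m\<close>, whereas
          \<open>x + \<tau>\<close> is within \<open>1/2 + 1/40\<close> of it; the remaining gap
          exceeds \<open>1/4\<close>.\<close>
        then have "1 \<le> \<bar>c - (n + q * i) - m\<bar>" by linarith
        then have "1 \<le> \<bar>real_of_int c - of_int (n + q * i) - of_int m\<bar>"
          by (metis (mono_tags) of_int_1_le_iff of_int_abs of_int_diff)
        then show "1 / 4 \<le> \<bar>x + \<tau> - of_int c\<bar>"
          using m_near t unfolding x_def by linarith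
      qed
      moreover have "68 / 100 \<le> norm (pulse_sum (of_real x))"
        unfolding x_def using nm t by (intro norm_pulse_sum_near_ge) auto
      moreover have "norm (pulse_sum (of_real x)) \<le> norm (pulse_sum (of_real (x + \<tau>))) +
          h x + h (x + \<tau>) + norm (g (of_real (x + \<tau>)) - g (of_real x))"
      proof -
        have "norm A \<le> norm B + norm (A - C) + norm (B - D) + norm (D - C)" for A B C D :: complex
          by norm
        then show ?thesis
          unfolding h_def .
      qed
      \<comment> \<open>The margin is \<open>68/100 - 2/15 - 1/4\<close>, which is greater than
        \<open>1/4\<close>.\<close>
      ultimately have "1 / 4 \<le> h x + h (x + \<tau>)"
        using period [of x] by linarith
      then show ?thesis by (simp add: x_def)
    qed
    \<comment> \<open>Each period \<open>q\<close> contains an interval of length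
      \<open>1/20\<close> on which \<open>u\<close>, defined below, is at least \<open>1/4\<close>,
      so \<open>u\<close> has mean at least \<open>1 / (80 * q)\<close>; the choice of
      \<open>\<eta>\<close> forces a mean of at most
      \<open>2 * \<eta> = 1 / (100 * q)\<close>.\<close>
    define \<eta> where "\<eta> = 1 / (200 * real_of_int q)"
    have \<eta>: "0 < \<eta>" using q by (simp add: \<eta>_def)
    define F where "F T z = ereal (1 / (2 * T) * integral {- T..T}
        (\<lambda>t. norm (pulse_sum (z + of_real t) - g (z + of_real t))))" for T z
    have "\<forall>\<^sub>F T in at_top. (SUP z\<in>strip (- H) H. F T z) < ereal \<eta>"
      using dist0 \<eta> unfolding weyl_dist_def F_def by (intro Limsup_lessD) simp
    then obtain T0 where T0: "\<And>T. T0 \<le> T \<Longrightarrow> (SUP z\<in>strip (- H) H. F T z) < ereal \<eta>"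
      unfolding eventually_at_top_linorder by blast
    obtain N where N: "max 1 (2 * T0) < real N"
      using reals_Archimedean2 by blast
    \<comment> \<open>With this \<open>T\<close> the interval \<open>{-T..T}\<close> consists of
      exactly \<open>N\<close> periods.\<close>
    define T where "T = real_of_int q * real N / 2"
    have "1 * real N \<le> real_of_int q * real N"
      using q by (intro mult_right_mono) auto
    then have T: "T0 \<le> T" "0 < T"
      using N unfolding T_def by linarith+
    \<comment> \<open>The supremum over the strip bounds the means around all real centres
      \<open>a\<close> with the same \<open>T\<close>; it is used for \<open>a\<close> and for
      \<open>a + \<tau>\<close>.\<close>
    have mean: "integral {-T..T} (\<lambda>t. h (a + t)) \<le> 2 * T * \<eta>" for a
    proof -
      have "F T (of_real a) < ereal \<eta>"
        using SUP_upper [OF line [of a], of "F T"] T0 [OF T(1)] by (rule le_less_trans)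
      then have "1 / (2 * T) * integral {- T..T} (\<lambda>t. h (a + t)) < \<eta>"
        by (simp add: F_def h_def)
      then have "2 * T * (1 / (2 * T) * integral {- T..T} (\<lambda>t. h (a + t))) \<le> 2 * T * \<eta>"
        using T by (intro mult_left_mono) auto
      then show ?thesis
        using T by simp
    qed
    \<comment> \<open>Chosen so that \<open>t = -T\<close> corresponds to \<open>n - 1/40\<close>,
      the left end of the first interval where \<open>h_ge\<close> applies.\<close>
    define a where "a = of_int n - 1 / 40 + T"
    define u where "u t = h (a + t) + h (a + \<tau> + t)" for t
    have conts: "continuous_on A (\<lambda>t. h (b + t))" for A b
      by (intro continuous_on_compose2 [OF cont_h] continuous_intros) auto
    have "real N * (1 / 20 * (1 / 4)) \<le> integral {-T..-T + real_of_int q * real N} u"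
    proof (rule integral_windows_ge)
      show "continuous_on UNIV u"
        unfolding u_def by (intro continuous_intros conts)
      show "0 \<le> u t" for t by (simp add: u_def h_def)
      fix i t assume t: "t \<in> {- T + real_of_int q * real i..- T + real_of_int q * real i + 1 / 20}"
      define r where "r = t + T - real_of_int q * real i - 1 / 40"
      have "\<bar>r\<bar> \<le> 1 / 40" using t unfolding r_def atLeastAtMost_iff by linarith
      then have "1 / 4 \<le> h (of_int (n + q * int i) + r) + h (of_int (n + q * int i) + r + \<tau>)"
        by (rule h_ge)
      moreover have "of_int (n + q * int i) + r = a + t" "a + t + \<tau> = a + \<tau> + t"
        by (simp_all add: a_def r_def)
      ultimately show "1 / 4 \<le> u t"
        by (simp only: u_def)
    qed (use q in auto)
    also have "-T + real_of_int q * real N = T"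
      by (simp add: T_def)
    also have "integral {-T..T} u = integral {-T..T} (\<lambda>t. h (a + t)) + integral {-T..T} (\<lambda>t. h (a + \<tau> + t))"
      unfolding u_def by (intro integral_add integrable_continuous_real conts)
    also have "\<dots> \<le> 2 * T * \<eta> + 2 * T * \<eta>"
      by (intro add_mono mean)
    also have "\<dots> = real N / 100"
      using q by (simp add: T_def \<eta>_def)
    finally show False using N by simp
  qed
qed

end
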